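(* Assume that $1<p<\infty$ and that $X$ is a proper connected metric space equipped with a locally doubling measure $\mu$ supporting a local $p$-Poincaré inequality. For open $\Omega\subset X$ and arbitrary (even unbounded) $E\subset\Omega$, let $$\widetilde{\mathrm{cap}}_p(E,\Omega)=\inf_u\int_\Omega g_u^p\,d\mu,$$ where the infimum is taken over all $u\in N^{1,p}(X)$ such that $\chi_E\le u\le\chi_\Omega$ (and is $\infty$ if there is no such $u$). Assume that $X$ is $p$-parabolic and that $\mu(X)=\infty$. Then the following hold: (a) $\widetilde{\mathrm{cap}}_p(E,X)=0$ for every bounded set $E\subset X$. (b) $\widetilde{\mathrm{cap}}_p(X,X)=\infty$. (c) $\widetilde{\mathrm{cap}}_p$ is not countably subadditive. (d) $\widetilde{\mathrm{cap}}_p$ is not a Choquet capacity.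
   Context: $X=(X,d,\mu)$ is a metric space equipped with a positive complete Borel measure $\mu$ with $0<\mu(B)<\infty$ for every ball $B$. Balls are open and come with a fixed centre and radius; $\lambda B(x,r):=B(x,\lambda r)$. $\overline{\mathbf{R}}=[-\infty,\infty]$ and $\chi_A$ is the characteristic function of $A$. Upper gradients. A curve is a nonconstant compact rectifiable curve, parameterized by arc length $ds$. A property holds for $p$-almost every curve if there is a nonnegative $\rho\in L^p(X)$ with $\int_\gamma\rho\,ds=\infty$ for every curve $\gamma$ for which it fails. A measurable $g:X\to[0,\infty]$ is a $p$-weak upper gradient of $f:X\to\overline{\mathbf{R}}$ if for $p$-almost all curves $\gamma:[0,l_\gamma]\to X$, $|f(\gamma(0))-f(\gamma(l_\gamma))|\le\int_\gamma g\,ds$, where the left-hand side is $\infty$ if at least one of the terms is infinite. If $f$ has a $p$-weak upper gradient in $L^p_{\rm loc}(X)$, then $g_f$ denotes its minimal $p$-weak upper gradient ($g_f\le g$ a.e. for every $p$-weak upper gradient $g\in L^p_{\rm loc}(X)$ of $f$). $N^{1,p}(X)$ is the space of measurable $f$, defined everywhere with values in $\overline{\mathbf{R}}$, with $\|f\|_{N^{1,p}(X)}^p=\int_X|f|^p\,d\mu+\inf_g\int_X g^p\,d\mu<\infty$, infimum over all $p$-weak upper gradients $g$ of $f$. For measurable $E\subset X$ these notions are defined by regarding $(E,d|_E,\mu|_E)$ as a metric space. Doubling and Poincaré. $\mu$ is doubling within an open set $U$ if there is $C>0$ with $\mu(2B)\le C\mu(B)$ for all balls $B\subset U$. The $p$-Poincaré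 inequality holds within $U$ if there are $C>0$, $\lambda\ge1$ such that for all balls $B\subset U$ with radius $r_B$, all integrable $u$ on $\lambda B$ and all $p$-weak upper gradients $g$ of $u$ in $\lambda B$, $\frac1{\mu(B)}\int_B|u-u_B|\,d\mu\le Cr_B\bigl(\frac1{\mu(\lambda B)}\int_{\lambda B}g^p\,d\mu\bigr)^{1/p}$, where $u_B=\frac1{\mu(B)}\int_B u\,d\mu$. Each property is local if for every $x\in X$ there is $r>0$ such that it holds within $B(x,r)$. $X$ is proper if all closed bounded sets are compact. Parabolicity. An unbounded $X$ is $p$-parabolic if for all compact $K\subset X$, $\mathrm{cap}_p(K,X):=\inf_u\int_X g_u^p\,d\mu=0$, infimum over $u\in N^{1,p}(X)$ with $\chi_K\le u\le1$. A set function $E\mapsto c(E,\Omega)$ on subsets $E$ of open sets $\Omega$ is countably subadditive if $c(\bigcup_{i=1}^\infty E_i,\Omega)\le\sum_{i=1}^\infty c(E_i,\Omega)$ for all open $\Omega$ and all $E_1,E_2,\dots\subset\Omega$. It is a Choquet capacity if for all open $\Omega$ it is monotone in $E$, satisfies $c(\bigcap_{i=1}^\infty K_i,\Omega)=\lim_{i\to\infty}c(K_i,\Omega)$ for all compact subsets $K_1\supset K_2\supset\cdots$ of $\Omega$, and satisfies $c(\bigcup_{i=1}^\infty E_i,\Omega)=\lim_{i\to\infty}c(E_i,\Omega)$ for all $E_1\subset E_2\subset\cdots\subset\Omega$. (In (c) and (d) the failure occurs already for $\Omega=X$.) *)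

theory Defs
  imports "HOL-Analysis.Analysis"
begin

text \<open>
  A metric measure space is given by a measure \<open>M\<close> on a type of class \<open>metric_space\<close>: its point set
  is \<open>space M\<close>, with the metric inherited from the type. The whole space \<open>X\<close> is \<open>UNIV\<close>, and a
  measurable \<open>E \<subseteq> X\<close>, regarded as a metric measure space, is \<open>restrict_space \<mu> E\<close>.

  Functions with values in \<open>[-\<infinity>,\<infinity>]\<close> have type \<open>ereal\<close>, those with values in \<open>[0,\<infinity>]\<close> have
  type \<open>ennreal\<close>.
\<close>

text \<open>
  A complete Borel measure is the completion of a measure on the Borel sets. Hence a measurable
  function is Borel off a null set, and its curve integrals make sense on \<open>p\<close>-almost every curve.
\<close>

definition metric_measure :: "'a::metric_space measure \<Rightarrow> bool" where
  "metric_measure \<mu> \<longleftrightarrow>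
     (\<exists>\<nu>. sets \<nu> = sets borel \<and> \<mu> = completion \<nu>) \<and>
     (\<forall>x r. 0 < r \<longrightarrow> 0 < emeasure \<mu> (ball x r) \<and> emeasure \<mu> (ball x r) < \<infinity>)"

definition proper_metric :: "'a::metric_space itself \<Rightarrow> bool" where
  "proper_metric _ \<longleftrightarrow> (\<forall>S :: 'a set. closed S \<and> bounded S \<longrightarrow> compact S)"

definition ennpow :: "ennreal \<Rightarrow> real \<Rightarrow> ennreal" where
  "ennpow a p = (if a = \<infinity> then \<infinity> else ennreal (enn2real a powr p))"  \<comment> \<open>only used for \<open>p > 0\<close>\<close>

definition Lp_pow :: "'a measure \<Rightarrow> real \<Rightarrow> ('a \<Rightarrow> ennreal) \<Rightarrow> ennreal" where
  "Lp_pow M p g = (\<integral>\<^sup>+x. ennpow (g x) p \<partial>M)"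

definition curve_length :: "(real \<Rightarrow> 'a::metric_space) \<Rightarrow> real \<Rightarrow> real \<Rightarrow> ennreal" where
  "curve_length \<gamma> s t =
     (SUP (n, \<tau>) \<in> {(n::nat, \<tau>). mono_on {..n} \<tau> \<and> \<tau> 0 = s \<and> \<tau> n = t}.
        \<Sum>i<n. ennreal (dist (\<gamma> (\<tau> i)) (\<gamma> (\<tau> (Suc i)))))"

text \<open>
  A nonconstant compact rectifiable curve in \<open>E\<close>, parameterized by arc length on \<open>[0,l]\<close>. The second
  condition makes \<open>\<gamma>\<close> 1-Lipschitz on \<open>[0,l]\<close>, so continuity need not be required separately.
\<close>

definition arclength_curve :: "'a::metric_space set \<Rightarrow> real \<Rightarrow> (real \<Rightarrow> 'a) \<Rightarrow> bool" where
  "arclength_curve E l \<gamma> \<longleftrightarrow>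
     0 < l \<and>
     (\<forall>s t. 0 \<le> s \<and> s \<le> t \<and> t \<le> l \<longrightarrow> curve_length \<gamma> s t = ennreal (t - s)) \<and>
     \<gamma> ` {0..l} \<subseteq> E"

definition curve_integral :: "real \<Rightarrow> (real \<Rightarrow> 'a) \<Rightarrow> ('a \<Rightarrow> ennreal) \<Rightarrow> ennreal" where
  "curve_integral l \<gamma> g = (\<integral>\<^sup>+t\<in>{0..l}. g (\<gamma> t) \<partial>lebesgue)"

definition almost_every_curve ::
    "'a::metric_space measure \<Rightarrow> real \<Rightarrow> (real \<Rightarrow> (real \<Rightarrow> 'a) \<Rightarrow> bool) \<Rightarrow> bool" where
  "almost_every_curve M p P \<longleftrightarrow>
     (\<exists>\<rho> \<in> borel_measurable M. Lp_pow M p \<rho> < \<infinity> \<and>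
        (\<forall>l \<gamma>. arclength_curve (space M) l \<gamma> \<and> \<not> P l \<gamma> \<longrightarrow> curve_integral l \<gamma> \<rho> = \<infinity>))"

definition ereal_gap :: "ereal \<Rightarrow> ereal \<Rightarrow> ennreal" where
  "ereal_gap a b = (if \<bar>a\<bar> = \<infinity> \<or> \<bar>b\<bar> = \<infinity> then \<infinity> else e2ennreal \<bar>a - b\<bar>)"

definition weak_upper_gradient ::
    "'a::metric_space measure \<Rightarrow> real \<Rightarrow> ('a \<Rightarrow> ereal) \<Rightarrow> ('a \<Rightarrow> ennreal) \<Rightarrow> bool" where
  "weak_upper_gradient M p f g \<longleftrightarrow>
     g \<in> borel_measurable M \<and>
     almost_every_curve M p (\<lambda>l \<gamma>. ereal_gap (f (\<gamma> 0)) (f (\<gamma> l)) \<le> curve_integral l \<gamma> g)"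

definition Lp_loc :: "'a::metric_space measure \<Rightarrow> real \<Rightarrow> ('a \<Rightarrow> ennreal) \<Rightarrow> bool" where
  "Lp_loc M p g \<longleftrightarrow>
     g \<in> borel_measurable M \<and>
     (\<forall>x \<in> space M. \<exists>r>0. (\<integral>\<^sup>+y\<in>ball x r. ennpow (g y) p \<partial>M) < \<infinity>)"

definition is_min_weak_upper_gradient ::
    "'a::metric_space measure \<Rightarrow> real \<Rightarrow> ('a \<Rightarrow> ereal) \<Rightarrow> ('a \<Rightarrow> ennreal) \<Rightarrow> bool" where
  "is_min_weak_upper_gradient M p f g \<longleftrightarrow>
     weak_upper_gradient M p f g \<and> Lp_loc M p g \<and>
     (\<forall>h. weak_upper_gradient M p f h \<and> Lp_loc M p h \<longrightarrow> (AE x in M. g x \<le> h x))"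

text \<open>
  The minimal \<open>p\<close>-weak upper gradient is determined only up to a null set; \<open>SOME\<close> picks a
  representative. It exists whenever \<open>f\<close> has a \<open>p\<close>-weak upper gradient in \<open>Lp_loc\<close>.
\<close>

definition min_weak_upper_gradient ::
    "'a::metric_space measure \<Rightarrow> real \<Rightarrow> ('a \<Rightarrow> ereal) \<Rightarrow> 'a \<Rightarrow> ennreal" where
  "min_weak_upper_gradient M p f = (SOME g. is_min_weak_upper_gradient M p f g)"

definition newtonian_norm_pow :: "'a::metric_space measure \<Rightarrow> real \<Rightarrow> ('a \<Rightarrow> ereal) \<Rightarrow> ennreal" where
  "newtonian_norm_pow M p f =
     Lp_pow M p (\<lambda>x. e2ennreal \<bar>f x\<bar>) + (INF g \<in> {g. weak_upper_gradient M p f g}. Lp_pow M p g)"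

definition newtonian :: "'a::metric_space measure \<Rightarrow> real \<Rightarrow> ('a \<Rightarrow> ereal) set" where
  "newtonian M p = {f \<in> borel_measurable M. newtonian_norm_pow M p f < \<infinity>}"

definition doubling_within :: "'a::metric_space measure \<Rightarrow> 'a set \<Rightarrow> bool" where
  "doubling_within \<mu> U \<longleftrightarrow>
     (\<exists>C::real. 0 < C \<and>
        (\<forall>x r. 0 < r \<and> ball x r \<subseteq> U \<longrightarrow>
           emeasure \<mu> (ball x (2 * r)) \<le> ennreal C * emeasure \<mu> (ball x r)))"

definition locally_doubling :: "'a::metric_space measure \<Rightarrow> bool" where
  "locally_doubling \<mu> \<longleftrightarrow> (\<forall>x. \<exists>r>0. doubling_within \<mu> (ball x r))"

definition ereal_integrable :: "'a measure \<Rightarrow> ('a \<Rightarrow> ereal) \<Rightarrow> bool" where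
  "ereal_integrable M u \<longleftrightarrow> u \<in> borel_measurable M \<and> (\<integral>\<^sup>+x. e2ennreal \<bar>u x\<bar> \<partial>M) < \<infinity>"

definition set_average :: "'a measure \<Rightarrow> 'a set \<Rightarrow> ('a \<Rightarrow> ereal) \<Rightarrow> real" where
  "set_average \<mu> B u = (LINT x:B|\<mu>. real_of_ereal (u x)) / measure \<mu> B"

definition poincare_within :: "'a::metric_space measure \<Rightarrow> real \<Rightarrow> 'a set \<Rightarrow> bool" where
  "poincare_within \<mu> p U \<longleftrightarrow>
     (\<exists>(C::real) (\<Lambda>::real). 0 < C \<and> 1 \<le> \<Lambda> \<and>
        (\<forall>x r u g.
           0 < r \<and> ball x r \<subseteq> U \<and>
           ereal_integrable (restrict_space \<mu> (ball x (\<Lambda> * r))) u \<and>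
           weak_upper_gradient (restrict_space \<mu> (ball x (\<Lambda> * r))) p u g \<longrightarrow>
           (\<integral>\<^sup>+y\<in>ball x r. e2ennreal \<bar>u y - ereal (set_average \<mu> (ball x r) u)\<bar> \<partial>\<mu>)
               / emeasure \<mu> (ball x r)
           \<le> ennreal (C * r) *
               ennpow ((\<integral>\<^sup>+y\<in>ball x (\<Lambda> * r). ennpow (g y) p \<partial>\<mu>) / emeasure \<mu> (ball x (\<Lambda> * r)))
                 (1 / p)))"

definition local_poincare :: "'a::metric_space measure \<Rightarrow> real \<Rightarrow> bool" where
  "local_poincare \<mu> p \<longleftrightarrow> (\<forall>x. \<exists>r>0. poincare_within \<mu> p (ball x r))"

definition cap :: "'a::metric_space measure \<Rightarrow> real \<Rightarrow> 'a set \<Rightarrow> ennreal" where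
  "cap \<mu> p K =
     (INF u \<in> {u \<in> newtonian \<mu> p. \<forall>x. indicator K x \<le> u x \<and> u x \<le> 1}.
        \<integral>\<^sup>+x. ennpow (min_weak_upper_gradient \<mu> p u x) p \<partial>\<mu>)"

definition parabolic :: "'a::metric_space measure \<Rightarrow> real \<Rightarrow> bool" where
  "parabolic \<mu> p \<longleftrightarrow> \<not> bounded (UNIV :: 'a set) \<and> (\<forall>K. compact K \<longrightarrow> cap \<mu> p K = 0)"

definition cap_tilde :: "'a::metric_space measure \<Rightarrow> real \<Rightarrow> 'a set \<Rightarrow> 'a set \<Rightarrow> ennreal" where
  "cap_tilde \<mu> p E \<Omega> =
     (INF u \<in> {u \<in> newtonian \<mu> p. \<forall>x. indicator E x \<le> u x \<and> u x \<le> indicator \<Omega> x}.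
        \<integral>\<^sup>+x\<in>\<Omega>. ennpow (min_weak_upper_gradient \<mu> p u x) p \<partial>\<mu>)"

definition countably_subadditive_setfun ::
    "('a::topological_space set \<Rightarrow> 'a set \<Rightarrow> ennreal) \<Rightarrow> bool" where
  "countably_subadditive_setfun c \<longleftrightarrow>
     (\<forall>\<Omega> (E :: nat \<Rightarrow> 'a set). open \<Omega> \<and> (\<forall>i. E i \<subseteq> \<Omega>) \<longrightarrow>
        c (\<Union>i. E i) \<Omega> \<le> (\<Sum>i. c (E i) \<Omega>))"

definition choquet_capacity :: "('a::topological_space set \<Rightarrow> 'a set \<Rightarrow> ennreal) \<Rightarrow> bool" where
  "choquet_capacity c \<longleftrightarrow>
     (\<forall>\<Omega>. open \<Omega> \<longrightarrow>
        (\<forall>E F. E \<subseteq> F \<and> F \<subseteq> \<Omega> \<longrightarrow> c E \<Omega> \<le> c F \<Omega>) \<and>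
        (\<forall>K :: nat \<Rightarrow> 'a set. (\<forall>i. compact (K i) \<and> K i \<subseteq> \<Omega>) \<and> decseq K \<longrightarrow>
           (\<lambda>i. c (K i) \<Omega>) \<longlonglongrightarrow> c (\<Inter>i. K i) \<Omega>) \<and>
        (\<forall>E :: nat \<Rightarrow> 'a set. (\<forall>i. E i \<subseteq> \<Omega>) \<and> incseq E \<longrightarrow>
           (\<lambda>i. c (E i) \<Omega>) \<longlonglongrightarrow> c (\<Union>i. E i) \<Omega>))"

end

theory Submission
  imports Defs
begin

text \<open>Properness makes the closure of a bounded set compact, so parabolicity together with
  \<open>cap_tilde_mono\<close> gives every bounded set capacity zero. The whole space is different:
  the only admissible function is the constant 1, and its p-th power has integral \<mu>(X) =
  \<infinity>, so it is not in the Newtonian space and the infimum runs over the empty set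
  (\<open>cap_tilde_UNIV_UNIV\<close>). Concentric balls of integer radii exhaust X, so a countable
  increasing union of sets of capacity zero has infinite capacity. This one sequence refutes both
  countable subadditivity and continuity along increasing sets.\<close>

lemma metric_measure_space:
  assumes "metric_measure (\<mu> :: 'a::metric_space measure)"
  shows "space \<mu> = UNIV"
proof -
  obtain \<nu> :: "'a measure" where "sets \<nu> = sets borel" and \<mu>: "\<mu> = completion \<nu>"
    using assms by (auto simp: metric_measure_def)
  then have "space \<nu> = UNIV"
    by (metis sets_eq_imp_space_eq space_borel)
  with \<mu> show ?thesis by simp
qed

text \<open>A larger set imposes a stronger lower bound on \<open>u\<close>, so fewer functions
  compete in the infimum.\<close>

lemma cap_tilde_mono:
  assumes "E \<subseteq> F"
  shows "cap_tilde \<mu> p E \<Omega> \<le> cap_tilde \<mu> p F \<Omega>"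
  unfolding cap_tilde_def
proof (rule INF_superset_mono)
  have "(indicator E x :: ereal) \<le> indicator F x" for x
    using assms by (auto simp: indicator_def)
  then show "{u \<in> newtonian \<mu> p. \<forall>x. indicator F x \<le> u x \<and> u x \<le> indicator \<Omega> x}
      \<subseteq> {u \<in> newtonian \<mu> p. \<forall>x. indicator E x \<le> u x \<and> u x \<le> indicator \<Omega> x}"
    by (auto intro: order_trans)
qed simp

lemma cap_tilde_UNIV_eq_cap: "cap_tilde \<mu> p K UNIV = cap \<mu> p K"
  by (simp add: cap_tilde_def cap_def)

lemma cap_tilde_bounded:
  fixes \<mu> :: "'a::metric_space measure"
  assumes "proper_metric TYPE('a)" "parabolic \<mu> p" "bounded E"
  shows "cap_tilde \<mu> p E UNIV = 0"
proof -
  have "compact (closure E)"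
    using assms(1,3) by (simp add: proper_metric_def bounded_closure)
  then have "cap_tilde \<mu> p (closure E) UNIV = 0"
    using assms(2) by (simp add: cap_tilde_UNIV_eq_cap parabolic_def)
  then show ?thesis
    using cap_tilde_mono[OF closure_subset, of \<mu> p E UNIV] by simp
qed

text \<open>The L^p part of the norm is already infinite, whatever the gradient part.\<close>

lemma const_1_notin_newtonian:
  assumes "emeasure \<mu> (space \<mu>) = \<infinity>"
  shows "(\<lambda>_. 1) \<notin> newtonian \<mu> p"
proof -
  have "e2ennreal 1 = 1"
    by (simp add: one_ennreal.abs_eq)
  then have "ennpow (e2ennreal \<bar>1 :: ereal\<bar>) p = 1"
    by (simp add: ennpow_def)
  then have "Lp_pow \<mu> p (\<lambda>_. e2ennreal \<bar>1 :: ereal\<bar>) = \<infinity>"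
    using assms by (simp add: Lp_pow_def)
  then show ?thesis
    by (simp add: newtonian_def newtonian_norm_pow_def)
qed

lemma cap_tilde_UNIV_UNIV:
  assumes "emeasure \<mu> (space \<mu>) = \<infinity>"
  shows "cap_tilde \<mu> p UNIV UNIV = \<infinity>"
proof -
  \<comment> \<open>Both bounds equal 1 everywhere, which pins \<open>u\<close> down
    pointwise.\<close>
  have "u = (\<lambda>_. 1)" if "\<forall>x. indicator UNIV x \<le> u x \<and> u x \<le> indicator UNIV x" for u :: "'a \<Rightarrow> ereal"
    using that by (auto intro: antisym)
  then have "{u \<in> newtonian \<mu> p. \<forall>x. indicator UNIV x \<le> u x \<and> u x \<le> indicator UNIV x} = {}"
    using const_1_notin_newtonian[OF assms] by blast
  then show ?thesis
    by (simp only: cap_tilde_def image_empty Inf_empty infinity_ennreal_def)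
qed

theorem proposition4p8:
  fixes \<mu> :: "'a::metric_space measure" and p :: real
  assumes "1 < p"
    and "metric_measure \<mu>"
    and "proper_metric TYPE('a)"
    and "connected (UNIV :: 'a set)"
    and "locally_doubling \<mu>"
    and "local_poincare \<mu> p"
    and "parabolic \<mu> p"
    and "emeasure \<mu> UNIV = \<infinity>"
  shows "(\<forall>E. bounded E \<longrightarrow> cap_tilde \<mu> p E UNIV = 0) \<and>
         cap_tilde \<mu> p UNIV UNIV = \<infinity> \<and>
         \<not> countably_subadditive_setfun (cap_tilde \<mu> p) \<and>
         \<not> choquet_capacity (cap_tilde \<mu> p)"
proof (intro conjI)
  show a: "\<forall>E. bounded E \<longrightarrow> cap_tilde \<mu> p E UNIV = 0"
    using cap_tilde_bounded assms(3,7) by blast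
  show b: "cap_tilde \<mu> p UNIV UNIV = \<infinity>"
    using assms(2,8) by (simp add: cap_tilde_UNIV_UNIV metric_measure_space)
  \<comment> \<open>\<open>undefined\<close> serves as an arbitrary fixed centre. \<open>B 0\<close>
    is empty, which is harmless.\<close>
  define B where "B i = ball (undefined :: 'a) (real i)" for i
  have UN_B: "(\<Union>i. B i) = UNIV"
    using reals_Archimedean2 by (auto simp: B_def)
  have cap_B: "cap_tilde \<mu> p (B i) UNIV = 0" for i
    using a by (simp add: B_def)
  have "incseq B"
    by (auto simp: incseq_def B_def)
  show "\<not> countably_subadditive_setfun (cap_tilde \<mu> p)"
  proof
    assume "countably_subadditive_setfun (cap_tilde \<mu> p)"
    then have "cap_tilde \<mu> p (\<Union>i. B i) UNIV \<le> (\<Sum>i. cap_tilde \<mu> p (B i) UNIV)"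
      unfolding countably_subadditive_setfun_def by blast
    then show False
      by (simp add: UN_B cap_B b)
  qed
  show "\<not> choquet_capacity (cap_tilde \<mu> p)"
  proof
    assume "choquet_capacity (cap_tilde \<mu> p)"
    then have "(\<lambda>i. cap_tilde \<mu> p (B i) UNIV) \<longlonglongrightarrow> cap_tilde \<mu> p (\<Union>i. B i) UNIV"
      \<comment> \<open>Only continuity along increasing sets is used, with \<Omega> = X; a sequence
        that is constantly 0 cannot tend to \<infinity>.\<close>
      using \<open>incseq B\<close> unfolding choquet_capacity_def by blast
    then show False
      by (simp add: UN_B cap_B b LIMSEQ_const_iff)
  qed
qed

end
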